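(* Let $n\in\mathbb{N}$, let $F=(F_1,\ldots,F_n)$ be an $n$-tuple of hermitian $3\times3$ complex matrices, let $D:=\dim(L(F))$, and let $p\in\mathbb{R}^n$ be a corner point of $L(F)$. Then $D\in\{0,1,2,3,4\}$ and, for $D\geq 2$, $L(F)$ is the convex hull of the union of $\{p\}$ (i) if $D=2$: with a segment whose affine hull does not contain $p$, or with an ellipse which contains $p$ in its affine hull but not in its convex hull; (ii) if $D=3$: with an ellipse whose affine hull does not contain $p$, or with an ellipsoid which contains $p$ in its affine hull but not in its convex hull; (iii) if $D=4$: with an ellipsoid whose affine hull does not contain $p$.
   Context: For an $n$-tuple $F=(F_1,\ldots,F_n)$ of hermitian $3\times3$ complex matrices the joint algebraic numerical range is $$L(F)=\{(\operatorname{tr}(\rho F_1),\ldots,\operatorname{tr}(\rho F_n))\mid \rho\in\mathcal{M}_3\}\subset\mathbb{R}^n,$$ where $\mathcal{M}_3$ is the set of positive semi-definite $3\times 3$ complex matrices of trace one. Its dimension $\dim(L(F))$ is the dimension of its affine hull. A corner point of a convex compact set $C\subset\mathbb{R}^n$ is a point $x\in C$ whose normal cone $N(x)=\{u\in\mathbb{R}^n\mid\langle u,y-x\rangle\leq 0\ \forall y\in C\}$ has dimension $n$. Segments, ellipses (affine images of the unit circle under injective affine maps $\mathbb{R}^2\to\mathbb{R}^n$) and ellipsoids (affine images of the unit sphere of $\mathbb{R}^3$ under injective affine maps $\mathbb{R}^3\to\mathbb{R}^n$) are non-degenerate; the affine hull of an ellipse is two-dimensional and the affine hull of an ellipsoid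 is three-dimensional. *)

theory Defs
  imports "HOL-Analysis.Analysis"
begin

definition hermitian :: "complex^'m^'m \<Rightarrow> bool" where
  "hermitian A \<longleftrightarrow> (\<forall>i j. A $ i $ j = cnj (A $ j $ i))"

definition positive_semidefinite :: "complex^'m^'m \<Rightarrow> bool" where
  "positive_semidefinite A \<longleftrightarrow>
     hermitian A \<and> (\<forall>v. 0 \<le> Re (\<Sum>i\<in>UNIV. cnj (v $ i) * (A *v v) $ i))"

definition density_matrices :: "(complex^'m^'m) set" where
  "density_matrices = {\<rho>. positive_semidefinite \<rho> \<and> trace \<rho> = 1}"

lemma trace_mult_hermitian_real:
  fixes A B :: "complex^'m^'m"
  assumes "hermitian A" "hermitian B"
  shows "trace (A ** B) \<in> \<real>"
proof -
  have "cnj (A $ i $ k * B $ k $ i) = A $ k $ i * B $ i $ k" for i k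
    using assms unfolding hermitian_def by (metis complex_cnj_mult)
  then have "cnj (trace (A ** B)) = (\<Sum>i\<in>UNIV. \<Sum>k\<in>UNIV. A $ k $ i * B $ i $ k)"
    by (simp add: trace_def matrix_matrix_mult_def)
  also have "\<dots> = trace (A ** B)"
    by (subst sum.swap) (simp add: trace_def matrix_matrix_mult_def)
  finally show ?thesis
    by (simp add: Reals_cnj_iff)
qed

text \<open>For a tuple of hermitian matrices the traces below are real by
  the preceding lemma, so taking real parts only converts the type.\<close>

definition joint_numerical_range :: "('n \<Rightarrow> complex^'m^'m) \<Rightarrow> (real^'n) set" where
  "joint_numerical_range F = {(\<chi> i. Re (trace (\<rho> ** F i))) | \<rho>. \<rho> \<in> density_matrices}"

definition normal_cone :: "'a::euclidean_space set \<Rightarrow> 'a \<Rightarrow> 'a set" where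
  "normal_cone C x = {u. \<forall>y\<in>C. u \<bullet> (y - x) \<le> 0}"

definition corner_point :: "'a::euclidean_space set \<Rightarrow> 'a \<Rightarrow> bool" where
  "corner_point C x \<longleftrightarrow> x \<in> C \<and> aff_dim (normal_cone C x) = int DIM('a)"

definition is_segment :: "'a::euclidean_space set \<Rightarrow> bool" where
  "is_segment S \<longleftrightarrow> (\<exists>a b. a \<noteq> b \<and> S = closed_segment a b)"

text \<open>Ellipses and ellipsoids are images of the unit circle and of the unit sphere (curves and
  surfaces, not solid bodies) under injective affine maps, written as a translation after
  an injective linear map.\<close>

definition is_ellipse :: "'a::euclidean_space set \<Rightarrow> bool" where
  "is_ellipse E \<longleftrightarrow>
     (\<exists>(f :: real^2 \<Rightarrow> 'a) c. linear f \<and> inj f \<and> E = (\<lambda>x. c + f x) ` sphere 0 1)"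

definition is_ellipsoid :: "'a::euclidean_space set \<Rightarrow> bool" where
  "is_ellipsoid E \<longleftrightarrow>
     (\<exists>(f :: real^3 \<Rightarrow> 'a) c. linear f \<and> inj f \<and> E = (\<lambda>x. c + f x) ` sphere 0 1)"

end

theory Submission
  imports Defs
begin

text \<open>
  A corner point \<open>p\<close> of the joint numerical range of a tuple \<open>F\<close> splits off as a one-dimensional
  direct summand. Let \<open>\<rho>\<close> be a density matrix representing \<open>p\<close>. A vector \<open>u\<close> in the normal cone
  at \<open>p\<close> says that \<open>M = \<Sum>i. u\<^sub>i (p\<^sub>i - F\<^sub>i)\<close> is positive semidefinite with \<open>tr (\<rho> M) = 0\<close>, so \<open>M\<close> kills
  the range of \<open>\<rho>\<close>. Fix a nonzero column \<open>v\<close> of \<open>\<rho>\<close>; it does not depend on \<open>u\<close>. The condition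
  \<open>M v = 0\<close> is linear in \<open>u\<close> and the normal cone of a corner has full dimension, so it holds for
  every \<open>u\<close>, and \<open>v\<close> is a common eigenvector with \<open>F\<^sub>i v = p\<^sub>i v\<close>
  (\<open>corner_point_common_eigenvector\<close>).

  A unitary change of basis, which leaves the numerical range unchanged, makes \<open>v\<close> the first basis
  vector. Then every \<open>F\<^sub>i\<close> is the direct sum of the scalar \<open>p\<^sub>i\<close> and a hermitian \<open>2 \<times> 2\<close> block. The
  density matrices of size two form the Bloch ball, so the numerical range of the blocks is the
  image of the unit ball of \<open>\<real>\<^sup>3\<close> under an affine map \<open>x \<mapsto> c + f x\<close>, and the range of \<open>F\<close> is the
  convex hull of \<open>p\<close> and this image (\<open>joint_numerical_range_common_eigenvector\<close>).

  What remains is convex geometry (\<open>cone_over_ball_image_with_corner\<close>). Let \<open>r\<close> be the rank of \<open>f\<close>.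
  The image of the ball is a point, a segment, or the convex hull of an ellipse or an ellipsoid
  for \<open>r = 0, 1, 2, 3\<close>, and the dimension \<open>D\<close> is \<open>r\<close> or \<open>r + 1\<close> according to whether \<open>p\<close> lies in the
  affine hull of the image. If \<open>r \<ge> 2\<close> then \<open>p\<close> cannot lie in the image itself, because the image
  has no corners (\<open>ball_image_corner_dim_le_1\<close>).
\<close>

section \<open>Hermitian forms and positive semidefinite matrices\<close>

definition hinner :: "complex^'m \<Rightarrow> complex^'m \<Rightarrow> complex" where
  "hinner x y = (\<Sum>i\<in>UNIV. cnj (x $ i) * y $ i)"

definition rank_one :: "complex^'m \<Rightarrow> complex^'m^'m" where
  "rank_one v = (\<chi> i j. v $ i * cnj (v $ j))"

lemma hinner_add:
  "hinner x (y + z) = hinner x y + hinner x z"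
  "hinner (x + y) z = hinner x z + hinner y z"
  by (simp_all add: hinner_def sum.distrib algebra_simps)

lemma hinner_diff:
  "hinner x (y - z) = hinner x y - hinner x z"
  "hinner (x - y) z = hinner x z - hinner y z"
  by (simp_all add: hinner_def sum_subtractf algebra_simps)

lemma hinner_scale: "hinner x (a *s y) = a * hinner x y" "hinner (a *s x) y = cnj a * hinner x y"
  by (simp_all add: hinner_def sum_distrib_left algebra_simps)

lemma cnj_hinner: "cnj (hinner x y) = hinner y x"
  by (simp add: hinner_def mult.commute)

lemma hinner_self: "hinner x x = complex_of_real ((norm x)\<^sup>2)"
proof -
  have "cnj z * z = complex_of_real ((norm z)\<^sup>2)" for z
    using complex_norm_square[of z] by (simp only: mult.commute)
  then show ?thesis
    unfolding hinner_def norm_vec_def L2_set_def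
    by (simp only: of_real_sum[symmetric] sum_nonneg real_sqrt_pow2 zero_le_power2)
qed

lemma hinner_hermitian: "hermitian A \<Longrightarrow> hinner (A *v x) y = hinner x (A *v y)"
proof -
  assume "hermitian A"
  then have "cnj (A $ i $ j) = A $ j $ i" for i j
    unfolding hermitian_def by metis
  then have "hinner (A *v x) y = (\<Sum>i\<in>UNIV. \<Sum>j\<in>UNIV. cnj (x $ j) * (A $ j $ i * y $ i))"
    by (simp add: hinner_def matrix_vector_mult_def sum_distrib_left sum_distrib_right mult_ac)
  also have "\<dots> = hinner x (A *v y)"
    by (subst sum.swap) (simp add: hinner_def matrix_vector_mult_def sum_distrib_left)
  finally show ?thesis .
qed

lemma hinner_form_real:
  assumes "hermitian A"
  shows "hinner x (A *v x) = complex_of_real (Re (hinner x (A *v x)))"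
  using cnj_hinner[of x "A *v x"] hinner_hermitian[OF assms, of x x]
  by (metis Reals_cnj_iff of_real_Re)

lemma positive_semidefinite_hinner:
  "positive_semidefinite A \<longleftrightarrow> hermitian A \<and> (\<forall>v. 0 \<le> Re (hinner v (A *v v)))"
  by (simp add: positive_semidefinite_def hinner_def)

lemma matrix_vector_mult_axis:
  "(A :: 'a::semiring_1^'m^'n) *v axis j 1 = column j A"
  by (simp add: vec_eq_iff matrix_vector_mult_def column_def axis_def if_distrib[of "\<lambda>x. _ * x"] cong: if_cong)

lemma hermitian_cnj: "hermitian A \<Longrightarrow> cnj (A $ i $ j) = A $ j $ i"
  unfolding hermitian_def by metis

lemma hermitian_add: "hermitian A \<Longrightarrow> hermitian B \<Longrightarrow> hermitian (A + B)"
  unfolding hermitian_def[of "A + B"] by (simp add: hermitian_cnj)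

lemma hermitian_diff: "hermitian A \<Longrightarrow> hermitian B \<Longrightarrow> hermitian (A - B)"
  unfolding hermitian_def[of "A - B"] by (simp add: hermitian_cnj)

lemma hermitian_scaleR: "hermitian A \<Longrightarrow> hermitian (r *\<^sub>R A)"
  unfolding hermitian_def[of "r *\<^sub>R A"] by (simp add: hermitian_cnj)

lemma hermitian_sum: "(\<And>i. i \<in> I \<Longrightarrow> hermitian (A i)) \<Longrightarrow> hermitian (\<Sum>i\<in>I. A i)"
  unfolding hermitian_def[of "sum A I"] by (simp add: hermitian_cnj)

lemma hermitian_mat_1: "hermitian (mat 1)"
  by (simp add: hermitian_def mat_def)

lemma hermitian_conjugate:
  assumes H: "hermitian H" and A: "hermitian A"
  shows "hermitian (H ** A ** H)"
proof -
  have cnj: "cnj ((A ** B) $ i $ j) = (B ** A) $ j $ i"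
    if "hermitian A" "hermitian B" for A B :: "complex^'a^'a" and i j
    using that by (simp add: matrix_matrix_mult_def hermitian_cnj mult.commute)
  have "cnj ((H ** A ** H) $ i $ j) = (H ** (A ** H)) $ j $ i" for i j
  proof -
    have "cnj ((H ** A ** H) $ i $ j) = (\<Sum>k\<in>UNIV. cnj ((H ** A) $ i $ k) * cnj (H $ k $ j))"
      by (simp add: matrix_matrix_mult_def[of "H ** A" H])
    also have "\<dots> = (H ** (A ** H)) $ j $ i"
      using H A by (simp add: cnj hermitian_cnj matrix_matrix_mult_def[of H "A ** H"] mult.commute)
    finally show ?thesis .
  qed
  then show ?thesis
    unfolding hermitian_def by (metis matrix_mul_assoc)
qed

lemma positive_semidefinite_add:
  "positive_semidefinite A \<Longrightarrow> positive_semidefinite B \<Longrightarrow> positive_semidefinite (A + B)"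
  by (simp add: positive_semidefinite_hinner hermitian_add hinner_add matrix_vector_mult_add_rdistrib)

lemma scaleR_matrix_vector: "((r *\<^sub>R A) *v x :: complex^'n) = r *\<^sub>R (A *v x)"
  by (simp add: vec_eq_iff matrix_vector_mult_def scaleR_sum_right)

lemma hinner_scaleR: "hinner x (r *\<^sub>R y) = r *\<^sub>R hinner x y"
  by (simp add: hinner_def scaleR_sum_right)

lemma positive_semidefinite_scaleR:
  "positive_semidefinite A \<Longrightarrow> 0 \<le> r \<Longrightarrow> positive_semidefinite (r *\<^sub>R A)"
  by (simp add: positive_semidefinite_hinner hermitian_scaleR scaleR_matrix_vector hinner_scaleR)

lemma rank_one_mult: "rank_one v *v x = hinner v x *s v"
  by (simp add: vec_eq_iff rank_one_def matrix_vector_mult_def hinner_def sum_distrib_left sum_distrib_right mult_ac)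

lemma hermitian_rank_one: "hermitian (rank_one v)"
  by (simp add: hermitian_def rank_one_def)

lemma positive_semidefinite_rank_one: "positive_semidefinite (rank_one v)"
proof -
  have "hinner x (rank_one v *v x) = complex_of_real ((norm (hinner v x))\<^sup>2)" for x
    unfolding rank_one_mult hinner_scale complex_norm_square cnj_hinner ..
  then show ?thesis
    by (simp add: positive_semidefinite_hinner hermitian_rank_one)
qed

lemma trace_rank_one_mult: "trace (rank_one v ** A) = hinner v (A *v v)"
proof -
  have "trace (rank_one v ** A) = (\<Sum>i\<in>UNIV. \<Sum>k\<in>UNIV. v $ i * cnj (v $ k) * A $ k $ i)"
    by (simp add: trace_def matrix_matrix_mult_def rank_one_def)
  also have "\<dots> = hinner v (A *v v)"
    by (subst sum.swap)
      (simp add: hinner_def matrix_vector_mult_def sum_distrib_left mult_ac)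
  finally show ?thesis .
qed

lemma hinner_axis: "hinner (axis j 1) x = x $ j" "hinner x (axis j 1) = cnj (x $ j)"
  by (simp_all add: hinner_def axis_def if_distrib[of "\<lambda>x. cnj x * _"] if_distrib[of "\<lambda>x. _ * x"] cong: if_cong)

lemma positive_semidefinite_diagonal_nonneg:
  assumes "positive_semidefinite A"
  shows "0 \<le> Re (A $ i $ i)"
proof -
  have "hinner (axis i 1) (A *v axis i 1) = A $ i $ i"
    by (simp add: matrix_vector_mult_axis hinner_axis column_def)
  then show ?thesis
    using assms by (metis positive_semidefinite_hinner)
qed

lemma trace_positive_semidefinite_nonneg:
  "positive_semidefinite A \<Longrightarrow> 0 \<le> Re (trace A)"
  by (simp add: trace_def sum_nonneg positive_semidefinite_diagonal_nonneg)

lemma trace_hermitian_real: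
  assumes "hermitian A"
  shows "trace A = complex_of_real (Re (trace A))"
proof -
  have "cnj (A $ i $ i) = A $ i $ i" for i
    using assms unfolding hermitian_def by metis
  then have "cnj (trace A) = trace A" by (simp add: trace_def)
  then show ?thesis by (metis Reals_cnj_iff of_real_Re)
qed

text \<open>If the form of \<open>M\<close> vanishes at \<open>v\<close>, then \<open>v\<close> minimises it, so the derivative in the direction
  \<open>- M v\<close>, which is \<open>- 2 |M v|\<^sup>2\<close>, cannot be negative.\<close>

lemma positive_semidefinite_null_vector:
  assumes M: "positive_semidefinite M" and v: "hinner v (M *v v) = 0"
  shows "M *v v = 0"
proof -
  have herm: "hermitian M" using M by (simp add: positive_semidefinite_hinner)
  define x where "x = M *v v"
  define a where "a = (norm x)\<^sup>2"
  define b where "b = Re (hinner x (M *v x))"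
  have b: "b \<ge> 0" using M by (simp add: b_def positive_semidefinite_hinner)
  have expand: "Re (hinner (v - s *\<^sub>R x) (M *v (v - s *\<^sub>R x))) = s\<^sup>2 * b - 2 * s * a" for s :: real
  proof -
    have sx: "s *\<^sub>R x = complex_of_real s *s x"
      by (simp add: vec_eq_iff scaleR_conv_of_real[where 'a=complex])
    have "hinner v (M *v x) = hinner x x"
      unfolding x_def by (rule hinner_hermitian[OF herm, symmetric])
    moreover have "hinner x (M *v v) = hinner x x" by (simp add: x_def)
    ultimately show ?thesis
      unfolding sx by (simp add: matrix_vector_mult_diff_distrib matrix_vector_mult_scaleR vector_scalar_commute
        hinner_diff hinner_scale v hinner_self a_def b_def power2_eq_square algebra_simps)
  qed
  \<comment> \<open>The minimum of \<open>s\<^sup>2 b - 2 s a\<close> is at \<open>a / b\<close>; the increment of \<open>b\<close> covers \<open>b = 0\<close>.\<close>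
  define s where "s = a / (b + 1)"
  have a: "a = s * (b + 1)" using b by (simp add: s_def)
  have "0 \<le> s\<^sup>2 * b - 2 * s * a"
    unfolding expand[symmetric] using M by (simp add: positive_semidefinite_hinner)
  also have "\<dots> = - (s\<^sup>2 * (b + 2))"
    unfolding a by (simp add: power2_eq_square algebra_simps)
  finally have "s = 0"
    using b by (simp add: mult_le_0_iff)
  then have "a = 0" by (simp add: a)
  then show ?thesis by (simp add: a_def x_def)
qed

text \<open>One step of the Cholesky decomposition. The value at \<open>x\<close> of the new form is the value of the old
  one at \<open>x - t e\<^sub>j\<close>, for the \<open>t\<close> that minimises the latter. The step replaces the spectral theorem
  below: it writes a density matrix as a positive multiple of a pure state plus a positive
  semidefinite remainder.\<close>

lemma positive_semidefinite_subtract_rank_one: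
  assumes A: "positive_semidefinite A" and d: "Re (A $ j $ j) > 0"
  shows "positive_semidefinite (A - (1 / Re (A $ j $ j)) *\<^sub>R rank_one (column j A))"
proof -
  define d where "d = Re (A $ j $ j)"
  define v where "v = column j A"
  define e :: "complex^'a" where "e = axis j 1"
  have herm: "hermitian A" using A by (simp add: positive_semidefinite_hinner)
  have Ae: "A *v e = v" by (simp add: e_def v_def matrix_vector_mult_axis)
  have "A $ j $ j = complex_of_real d"
    using hermitian_cnj[OF herm, of j j] unfolding d_def by (metis Reals_cnj_iff of_real_Re)
  then have ev: "hinner e v = complex_of_real d"
    by (simp add: e_def hinner_axis v_def column_def)
  have "0 \<le> Re (hinner x ((A - (1 / d) *\<^sub>R rank_one v) *v x))" for x
  proof -
    define t where "t = hinner v x / complex_of_real d"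
    have vx: "hinner v x = t * complex_of_real d"
      using d by (simp add: t_def d_def)
    have xv: "hinner x v = cnj t * complex_of_real d"
      using cnj_hinner[of v x] by (simp add: vx)
    have eA: "hinner e (A *v x) = t * complex_of_real d"
      using hinner_hermitian[OF herm, of e x] by (simp add: Ae vx)
    have "hinner (x - t *s e) (A *v (x - t *s e)) =
        hinner x (A *v x) - cnj t * t * complex_of_real d"
      by (simp add: matrix_vector_mult_diff_distrib vector_scalar_commute hinner_diff
        hinner_scale Ae eA xv ev algebra_simps)
    also have "\<dots> = hinner x ((A - (1 / d) *\<^sub>R rank_one v) *v x)"
      using d unfolding d_def[symmetric]
      by (simp add: matrix_vector_mult_diff_rdistrib scaleR_matrix_vector hinner_diff hinner_scaleR
        rank_one_mult hinner_scale vx xv scaleR_conv_of_real[where 'a=complex])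
    finally show ?thesis
      using A by (metis positive_semidefinite_hinner)
  qed
  then show ?thesis
    unfolding positive_semidefinite_hinner d_def[symmetric] v_def[symmetric]
    using herm by (simp add: hermitian_diff hermitian_scaleR hermitian_rank_one)
qed

text \<open>The nonnegativity of the principal \<open>2 \<times> 2\<close> minors, read off from the diagonal of the remainder in a
  Cholesky step; a zero on the diagonal forces a zero column.\<close>

lemma positive_semidefinite_entry_bound:
  assumes A: "positive_semidefinite A"
  shows "(norm (A $ i $ j))\<^sup>2 \<le> Re (A $ i $ i) * Re (A $ j $ j)"
proof -
  have herm: "hermitian A" using A by (simp add: positive_semidefinite_hinner)
  define d where "d = Re (A $ j $ j)"
  have d: "d \<ge> 0" unfolding d_def using A by (rule positive_semidefinite_diagonal_nonneg)
  show ?thesis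
  proof (cases "d = 0")
    case True
    have "A $ j $ j = 0"
      using hermitian_cnj[OF herm, of j j] True by (simp add: complex_eq_iff d_def)
    then have "hinner (axis j 1) (A *v axis j 1) = 0"
      by (simp add: hinner_axis matrix_vector_mult_axis column_def)
    from positive_semidefinite_null_vector[OF A this] have "A $ i $ j = 0"
      by (simp add: matrix_vector_mult_axis column_def vec_eq_iff)
    then show ?thesis using True by (simp add: d_def[symmetric])
  next
    case False
    with d have "d > 0" by simp
    then have "positive_semidefinite (A - (1 / d) *\<^sub>R rank_one (column j A))"
      unfolding d_def using positive_semidefinite_subtract_rank_one[OF A] by blast
    from positive_semidefinite_diagonal_nonneg[OF this, of i]
    have "0 \<le> Re (A $ i $ i) - (norm (A $ i $ j))\<^sup>2 / d"
      by (simp add: rank_one_def column_def cmod_power2 power2_eq_square[of "Re _"] power2_eq_square[of "Im _"])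
    then show ?thesis
      using \<open>d > 0\<close> by (simp add: d_def[symmetric] field_simps)
  qed
qed

section \<open>Density matrices and the joint numerical range\<close>

lemma trace_scaleR: "trace (r *\<^sub>R A) = complex_of_real r * trace (A :: complex^'m^'m)"
  by (simp add: trace_def sum_distrib_left scaleR_conv_of_real[where 'a=complex])

lemma convex_density_matrices: "convex (density_matrices :: (complex^'m^'m) set)"
  unfolding convex_def density_matrices_def
  by (auto simp: positive_semidefinite_add positive_semidefinite_scaleR trace_add trace_scaleR
      simp flip: of_real_add)

lemma linear_trace_mult_right: "linear (\<lambda>A. Re (trace (\<sigma> ** (A :: complex^'m^'m))))"
proof (rule linearI)
  fix A B :: "complex^'m^'m" and r :: real
  show "Re (trace (\<sigma> ** (A + B))) = Re (trace (\<sigma> ** A)) + Re (trace (\<sigma> ** B))"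
    by (simp add: matrix_add_ldistrib trace_add)
  have "\<sigma> ** (r *\<^sub>R A) = r *\<^sub>R (\<sigma> ** A)"
    by (simp add: vec_eq_iff matrix_matrix_mult_def scaleR_sum_right)
  then show "Re (trace (\<sigma> ** (r *\<^sub>R A))) = r *\<^sub>R Re (trace (\<sigma> ** A))"
    by (simp add: trace_scaleR)
qed

lemma linear_trace_mult_left: "linear (\<lambda>A. Re (trace ((A :: complex^'m^'m) ** B)))"
  unfolding trace_mul_sym[of _ B] by (rule linear_trace_mult_right)

lemma joint_numerical_range_image:
  "joint_numerical_range F = (\<lambda>\<rho>. \<chi> i. Re (trace (\<rho> ** F i))) ` density_matrices"
  by (auto simp: joint_numerical_range_def)

lemma convex_joint_numerical_range:
  fixes F :: "'n::finite \<Rightarrow> complex^'m^'m"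
  shows "convex (joint_numerical_range F)"
proof -
  have "linear (\<lambda>\<rho>. \<chi> i. Re (trace (\<rho> ** F i)))"
    using linear_trace_mult_left[of "F _"] by (simp add: linear_iff vec_eq_iff)
  then show ?thesis
    unfolding joint_numerical_range_image
    by (intro convex_linear_image convex_density_matrices)
qed

text \<open>Positive semidefinite matrices of trace zero cannot be scaled to density matrices. Averaging with
  \<open>\<rho>\<close>, where the functional vanishes, treats all \<open>\<tau>\<close> alike.\<close>

lemma trace_mult_nonneg_if_nonneg_on_densities:
  assumes M: "\<And>\<sigma>. \<sigma> \<in> density_matrices \<Longrightarrow> 0 \<le> Re (trace (\<sigma> ** M))"
    and \<rho>: "\<rho> \<in> density_matrices" "Re (trace (\<rho> ** M)) = 0"
    and \<tau>: "positive_semidefinite \<tau>"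
  shows "0 \<le> Re (trace (\<tau> ** M))"
proof -
  define r where "r = 1 + Re (trace \<tau>)"
  have r: "r > 0"
    using trace_positive_semidefinite_nonneg[OF \<tau>] by (simp add: r_def)
  have "trace (\<rho> + \<tau>) = complex_of_real r"
    using \<rho>(1) trace_hermitian_real[of \<tau>] \<tau>
    by (simp add: r_def trace_add density_matrices_def positive_semidefinite_hinner)
  then have "(1 / r) *\<^sub>R (\<rho> + \<tau>) \<in> density_matrices"
    using \<rho>(1) \<tau> r unfolding density_matrices_def
    by (simp add: trace_scaleR positive_semidefinite_scaleR positive_semidefinite_add del: scaleR_add_right)
  from M[OF this] have "0 \<le> (1 / r) * (Re (trace (\<rho> ** M)) + Re (trace (\<tau> ** M)))"
    by (simp only: linear_scale[OF linear_trace_mult_left] linear_add[OF linear_trace_mult_left] real_scaleR_def)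
  then show ?thesis
    using r \<rho>(2) by (simp add: zero_le_divide_iff)
qed

section \<open>Common eigenvectors at corner points\<close>

text \<open>For \<open>u\<close> in the normal cone the functional \<open>tr (\<sigma> M)\<close> is nonnegative on density matrices and zero
  at \<open>\<rho>\<close>. As \<open>\<rho>\<close> is a positive multiple of \<open>v v\<^sup>*\<close> plus a positive semidefinite \<open>\<tau>\<close>, it is zero at
  \<open>v v\<^sup>*\<close> too, which gives \<open>M v = 0\<close>. Being a corner enters through the affine hull of the normal cone:
  a subspace that contains the cone is the whole space.\<close>

lemma corner_point_common_eigenvector:
  fixes F :: "'n::finite \<Rightarrow> complex^'m^'m"
  assumes F: "\<And>i. hermitian (F i)" and p: "corner_point (joint_numerical_range F) p"
  obtains v where "v \<noteq> 0" "\<And>i. F i *v v = complex_of_real (p $ i) *s v"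
proof -
  obtain \<rho> where \<rho>: "\<rho> \<in> density_matrices" "p = (\<chi> i. Re (trace (\<rho> ** F i)))"
    using p by (auto simp: corner_point_def joint_numerical_range_image)
  have psd: "positive_semidefinite \<rho>" and tr: "trace \<rho> = 1"
    using \<rho>(1) by (auto simp: density_matrices_def)
  have "\<exists>j. Re (\<rho> $ j $ j) > 0"
  proof (rule ccontr)
    assume "\<nexists>j. Re (\<rho> $ j $ j) > 0"
    then have "Re (trace \<rho>) \<le> 0"
      unfolding trace_def Re_sum by (intro sum_nonpos) (simp add: not_less)
    then show False by (simp add: tr)
  qed
  then obtain j where j: "Re (\<rho> $ j $ j) > 0" by blast
  define d where "d = Re (\<rho> $ j $ j)"
  define v where "v = column j \<rho>"
  define \<tau> where "\<tau> = \<rho> - (1 / d) *\<^sub>R rank_one v"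
  have \<tau>: "positive_semidefinite \<tau>"
    using positive_semidefinite_subtract_rank_one[OF psd j] by (simp add: \<tau>_def d_def v_def)
  have "v \<noteq> 0"
    using j by (auto simp: v_def column_def vec_eq_iff intro!: exI[of _ j])
  define w where "w i = complex_of_real (p $ i) *s v - F i *v v" for i
  have normal: "(\<Sum>i\<in>UNIV. u $ i *\<^sub>R w i) = 0"
    if u: "u \<in> normal_cone (joint_numerical_range F) p" for u
  proof -
    define M where "M = (\<Sum>i\<in>UNIV. u $ i *\<^sub>R (p $ i *\<^sub>R mat 1 - F i))"
    have hM: "hermitian M"
      unfolding M_def by (intro hermitian_sum hermitian_scaleR hermitian_diff hermitian_mat_1 F)
    have trM: "Re (trace (\<sigma> ** M)) = u \<bullet> (p - (\<chi> i. Re (trace (\<sigma> ** F i))))"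
      if "trace \<sigma> = 1" for \<sigma>
      unfolding M_def
      by (simp add: linear_sum[OF linear_trace_mult_right] linear_scale[OF linear_trace_mult_right]
         linear_diff[OF linear_trace_mult_right] that inner_vec_def)
    have "0 \<le> Re (trace (\<sigma> ** M))" if "\<sigma> \<in> density_matrices" for \<sigma>
    proof -
      have "u \<bullet> ((\<chi> i. Re (trace (\<sigma> ** F i))) - p) \<le> 0"
        using u that by (auto simp: normal_cone_def joint_numerical_range_image)
      then show ?thesis
        using that trM[of \<sigma>] by (simp add: density_matrices_def inner_diff_right)
    qed
    moreover have tr0: "Re (trace (\<rho> ** M)) = 0"
      using trM[OF tr] \<rho>(2) by simp
    ultimately have nonneg: "0 \<le> Re (trace (A ** M))" if "positive_semidefinite A" for A
      using trace_mult_nonneg_if_nonneg_on_densities[of M \<rho> A] \<rho>(1) that by blast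
    have "positive_semidefinite M"
      unfolding positive_semidefinite_hinner trace_rank_one_mult[symmetric]
      using hM nonneg positive_semidefinite_rank_one by blast
    moreover have "hinner v (M *v v) = 0"
    proof -
      have "Re (trace (\<tau> ** M)) = Re (trace (\<rho> ** M)) - (1 / d) * Re (trace (rank_one v ** M))"
        unfolding \<tau>_def by (simp only: linear_scale[OF linear_trace_mult_left]
            linear_diff[OF linear_trace_mult_left] real_scaleR_def)
      moreover have "0 \<le> Re (trace (rank_one v ** M))"
        by (intro nonneg positive_semidefinite_rank_one)
      ultimately have "Re (trace (rank_one v ** M)) = 0"
        using nonneg[OF \<tau>] j by (simp add: tr0 d_def mult_le_0_iff divide_le_0_iff)
      then show ?thesis
        using hinner_form_real[OF hM, of v] by (simp add: trace_rank_one_mult)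
    qed
    ultimately have "M *v v = 0"
      by (rule positive_semidefinite_null_vector)
    moreover have "M *v v = (\<Sum>i\<in>UNIV. u $ i *\<^sub>R w i)"
    proof -
      have lin: "linear (\<lambda>A. A *v v)"
        by (intro linearI) (simp_all add: matrix_vector_mult_add_rdistrib scaleR_matrix_vector)
      have "(p $ i *\<^sub>R mat 1 - F i) *v v = w i" for i
        by (simp add: matrix_vector_mult_diff_rdistrib scaleR_matrix_vector w_def)
          (simp add: vec_eq_iff of_real_def)
      then show ?thesis
        unfolding M_def by (simp add: linear_sum[OF lin] linear_scale[OF lin])
    qed
    ultimately show ?thesis by simp
  qed
  define S where "S = {u. (\<Sum>i\<in>UNIV. u $ i *\<^sub>R w i) = 0}"
  have "subspace S"
    unfolding S_def subspace_def
    by (auto simp: scaleR_add_left sum.distrib simp flip: scaleR_scaleR scaleR_sum_right)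
  moreover have "normal_cone (joint_numerical_range F) p \<subseteq> S"
    using normal by (auto simp: S_def)
  moreover have "affine hull (normal_cone (joint_numerical_range F) p) = UNIV"
    using p unfolding corner_point_def by (intro affine_hull_UNIV) simp
  ultimately have "S = UNIV"
    by (metis hull_minimal subspace_imp_affine top.extremum_uniqueI)
  have "w i = 0" for i
  proof -
    have "axis i 1 \<in> S" using \<open>S = UNIV\<close> by simp
    then show ?thesis
      by (simp add: S_def axis_def if_distrib[of "\<lambda>x. x *\<^sub>R _"] cong: if_cong)
  qed
  then show thesis
    using that[OF \<open>v \<noteq> 0\<close>] by (simp add: w_def)
qed

section \<open>Unitary change of basis\<close>

text \<open>The Householder reflection that exchanges \<open>x\<close> and \<open>e\<^sub>k\<close>, for the unit multiple \<open>x\<close> of \<open>v\<close> whose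
  \<open>k\<close>-th entry is real and at most zero. A real entry is what allows a reflection to exchange the two
  vectors, and the sign keeps \<open>w = x - e\<^sub>k\<close> away from zero. Since the reflection is its own adjoint
  and its own inverse, conjugation by it needs no adjoint matrices.\<close>

lemma exists_hermitian_unitary_with_column:
  fixes v :: "complex^'m"
  assumes "v \<noteq> 0"
  obtains H a where "hermitian H" "H ** H = mat 1" "H *v axis k 1 = a *s v"
proof -
  \<comment> \<open>If \<open>v $ k = 0\<close>, any phase will do.\<close>
  define c where "c = (if v $ k = 0 then 1 else - (cnj (v $ k) / complex_of_real (norm (v $ k))))
    / complex_of_real (norm v)"
  define r where "r = norm (v $ k) / norm v"
  define x where "x = c *s v"
  have xk: "x $ k = - complex_of_real r"
  proof (cases "v $ k = 0")
    case False
    have "cnj (v $ k) * v $ k = complex_of_real (norm (v $ k)) * complex_of_real (norm (v $ k))"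
      using complex_norm_square[of "v $ k"] by (simp add: power2_eq_square mult.commute)
    with False show ?thesis
      by (simp add: x_def c_def r_def field_simps)
  qed (simp add: x_def c_def r_def)
  have "norm c = 1 / norm v"
    by (simp add: c_def norm_divide norm_mult)
  then have c: "cnj c * c = complex_of_real ((1 / norm v)\<^sup>2)"
    using complex_norm_square[of c] by (simp only: mult.commute)
  have "hinner x x = (cnj c * c) * hinner v v"
    by (simp add: x_def hinner_scale)
  also have "\<dots> = 1"
    unfolding c hinner_self using assms by (simp add: power_divide flip: of_real_mult)
  finally have xx: "hinner x x = 1" .
  have r: "r \<ge> 0" by (simp add: r_def)
  define e :: "complex^'m" where "e = axis k 1"
  define w where "w = x - e"
  define H where "H = mat 1 - (1 / (1 + r)) *\<^sub>R rank_one w"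
  have r1: "complex_of_real (1 + r) \<noteq> 0"
    using r by (simp only: of_real_eq_0_iff)
  have we: "hinner w e = - complex_of_real (1 + r)"
    by (simp add: w_def e_def hinner_axis xk)
  \<comment> \<open>The reflection in \<open>w\<close> subtracts \<open>2 / |w|\<^sup>2\<close> times \<open>w w\<^sup>*\<close>; this factor is \<open>1 / (1 + r)\<close>.\<close>
  have ww: "hinner w w = 2 * complex_of_real (1 + r)"
    unfolding w_def by (simp add: hinner_diff xx e_def hinner_axis xk)
  have H: "H *v y = y - (hinner w y / complex_of_real (1 + r)) *s w" for y
    by (simp add: H_def matrix_vector_mult_diff_rdistrib scaleR_matrix_vector rank_one_mult)
      (simp add: vec_eq_iff scaleR_conv_of_real[where 'a=complex])
  have "(H ** H) *v y = mat 1 *v y" for y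
  proof -
    have "hinner w (H *v y) = - hinner w y"
      using r1 by (simp add: H hinner_diff hinner_scale ww field_simps)
    then show ?thesis
      by (simp add: H matrix_vector_mul_assoc[symmetric])
  qed
  then have "H ** H = mat 1" by (simp add: matrix_eq)
  moreover have "hermitian H"
    unfolding H_def by (intro hermitian_diff hermitian_scaleR hermitian_mat_1 hermitian_rank_one)
  moreover have "H *v axis k 1 = c *s v"
    using r1 unfolding H e_def[symmetric] we by (simp add: w_def x_def[symmetric] del: of_real_add)
  ultimately show thesis using that by blast
qed

lemma density_matrix_conjugate:
  assumes H: "hermitian H" "H ** H = mat 1" and \<rho>: "\<rho> \<in> density_matrices"
  shows "H ** \<rho> ** H \<in> density_matrices"
proof -
  have h\<rho>: "hermitian \<rho>" and pos: "\<And>v. 0 \<le> Re (hinner v (\<rho> *v v))" and tr: "trace \<rho> = 1"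
    using \<rho> by (auto simp: density_matrices_def positive_semidefinite_hinner)
  have "trace (H ** \<rho> ** H) = trace (H ** (H ** \<rho>))"
    by (rule trace_mul_sym)
  then have "trace (H ** \<rho> ** H) = 1"
    by (simp add: matrix_mul_assoc H tr)
  moreover have "hinner v ((H ** \<rho> ** H) *v v) = hinner (H *v v) (\<rho> *v (H *v v))" for v
    by (simp add: hinner_hermitian[OF H(1)] matrix_vector_mul_assoc matrix_mul_assoc)
  moreover have "hermitian (H ** \<rho> ** H)"
    using H(1) h\<rho> by (rule hermitian_conjugate)
  ultimately show ?thesis
    using pos by (simp add: density_matrices_def positive_semidefinite_hinner)
qed

lemma joint_numerical_range_conjugate:
  assumes H: "hermitian H" "H ** H = mat 1"
  shows "joint_numerical_range (\<lambda>i. H ** F i ** H) = joint_numerical_range F"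
proof -
  have tr: "trace (H ** \<rho> ** H ** A) = trace (\<rho> ** (H ** A ** H))" for \<rho> A
    using trace_mul_sym[of H "\<rho> ** H ** A"] by (simp add: matrix_mul_assoc)
  have HH: "H ** (H ** A ** H) ** H = A" for A
  proof -
    have "H ** (H ** A ** H) ** H = (H ** H) ** A ** (H ** H)"
      by (simp only: matrix_mul_assoc)
    then show ?thesis by (simp add: H)
  qed
  show ?thesis
  proof
    show "joint_numerical_range (\<lambda>i. H ** F i ** H) \<subseteq> joint_numerical_range F"
      unfolding joint_numerical_range_image tr[symmetric]
      using density_matrix_conjugate[OF H] by auto
    show "joint_numerical_range F \<subseteq> joint_numerical_range (\<lambda>i. H ** F i ** H)"
    proof
      fix q assume "q \<in> joint_numerical_range F"
      then obtain \<rho> where \<rho>: "\<rho> \<in> density_matrices" "q = (\<chi> i. Re (trace (\<rho> ** F i)))"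
        by (auto simp: joint_numerical_range_image)
      have "q = (\<chi> i. Re (trace ((H ** \<rho> ** H) ** (H ** F i ** H))))"
        unfolding tr HH \<rho>(2) ..
      then show "q \<in> joint_numerical_range (\<lambda>i. H ** F i ** H)"
        using density_matrix_conjugate[OF H \<rho>(1)] by (auto simp: joint_numerical_range_image)
    qed
  qed
qed

section \<open>Matrices with a one-dimensional block\<close>

text \<open>A state of the two-dimensional summand, extended by zero to the first basis vector. It need not
  be normalised.\<close>

definition block_state :: "real \<Rightarrow> real \<Rightarrow> complex \<Rightarrow> complex^3^3" where
  "block_state a b z = (\<chi> i j. if i = 2 \<and> j = 2 then complex_of_real a
     else if i = 3 \<and> j = 3 then complex_of_real b
     else if i = 2 \<and> j = 3 then z else if i = 3 \<and> j = 2 then cnj z else 0)"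

lemma positive_semidefinite_block_state:
  assumes ab: "0 \<le> a" "0 \<le> b" and z: "(norm z)\<^sup>2 \<le> a * b"
  shows "positive_semidefinite (block_state a b z)"
proof -
  have "0 \<le> Re (hinner v (block_state a b z *v v))" for v
  proof -
    define s where "s = norm (v $ 2)"
    define t where "t = norm (v $ 3)"
    define y where "y = cnj (v $ 2) * z * v $ 3"
    have sq: "cnj x * x = complex_of_real ((norm x)\<^sup>2)" for x
      using complex_norm_square[of x] by (simp only: mult.commute)
    have "hinner v (block_state a b z *v v) =
        complex_of_real a * (cnj (v $ 2) * v $ 2) + complex_of_real b * (cnj (v $ 3) * v $ 3) + (y + cnj y)"
      by (simp add: hinner_def matrix_vector_mult_def sum_3 block_state_def y_def algebra_simps)
    then have form: "Re (hinner v (block_state a b z *v v)) = a * s\<^sup>2 + b * t\<^sup>2 + 2 * Re y"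
      unfolding sq by (simp add: s_def t_def flip: of_real_mult)
    have "norm y = s * norm z * t" by (simp add: y_def s_def t_def norm_mult)
    then have y: "- (s * norm z * t) \<le> Re y"
      using abs_Re_le_cmod[of y] by linarith
    have "(2 * (s * norm z * t))\<^sup>2 = 4 * s\<^sup>2 * t\<^sup>2 * (norm z)\<^sup>2"
      by (simp add: power_mult_distrib)
    also have "\<dots> \<le> 4 * s\<^sup>2 * t\<^sup>2 * (a * b)"
      using z by (intro mult_left_mono) auto
    also have "\<dots> \<le> (a * s\<^sup>2 + b * t\<^sup>2)\<^sup>2"
      using zero_le_power2[of "a * s\<^sup>2 - b * t\<^sup>2"] by (simp add: power2_eq_square algebra_simps)
    finally have "2 * (s * norm z * t) \<le> a * s\<^sup>2 + b * t\<^sup>2"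
      by (rule power2_le_imp_le) (use ab in simp)
    then show ?thesis unfolding form using y by linarith
  qed
  moreover have "hermitian (block_state a b z)"
    unfolding hermitian_def forall_3 by (simp add: block_state_def)
  ultimately show ?thesis by (simp add: positive_semidefinite_hinner)
qed

lemma trace_mult_block:
  fixes \<rho> G :: "complex^3^3"
  assumes \<rho>: "hermitian \<rho>" and G: "hermitian G" and e: "G *v axis 1 1 = complex_of_real q *s axis 1 1"
  shows "Re (trace (\<rho> ** G)) = Re (\<rho> $ 1 $ 1) * q + Re (\<rho> $ 2 $ 2) * Re (G $ 2 $ 2)
    + Re (\<rho> $ 3 $ 3) * Re (G $ 3 $ 3)
    + 2 * (Re (\<rho> $ 2 $ 3) * Re (G $ 2 $ 3) + Im (\<rho> $ 2 $ 3) * Im (G $ 2 $ 3))"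
proof -
  have col: "G $ i $ 1 = complex_of_real q * axis 1 1 $ i" for i
    using e by (simp add: matrix_vector_mult_axis column_def vec_eq_iff)
  have G1: "G $ 1 $ 1 = complex_of_real q" "G $ 2 $ 1 = 0" "G $ 3 $ 1 = 0"
    by (simp_all add: col axis_def)
  have G2: "G $ 1 $ 2 = 0" "G $ 1 $ 3 = 0" "G $ 3 $ 2 = cnj (G $ 2 $ 3)"
    using hermitian_cnj[OF G, of 2 1] hermitian_cnj[OF G, of 3 1] hermitian_cnj[OF G, of 2 3] G1
    by simp_all
  have "\<rho> $ 3 $ 2 = cnj (\<rho> $ 2 $ 3)" "Im (\<rho> $ 2 $ 2) = 0" "Im (\<rho> $ 3 $ 3) = 0"
    using hermitian_cnj[OF \<rho>, of 2 3] hermitian_cnj[OF \<rho>, of 2 2] hermitian_cnj[OF \<rho>, of 3 3]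
    by (simp_all add: complex_eq_iff)
  then show ?thesis
    by (simp add: trace_def matrix_matrix_mult_def sum_3 G1 G2)
qed

text \<open>The Bloch ball: the vector \<open>x\<close> of \<open>\<real>\<^sup>3\<close> corresponds to the \<open>2 \<times> 2\<close> matrix with diagonal
  \<open>(1 \<plusminus> x\<^sub>3) / 2\<close> and upper right entry \<open>(x\<^sub>1 + \<i> x\<^sub>2) / 2\<close>, whose determinant is \<open>(1 - |x|\<^sup>2) / 4\<close>. The matrices
  \<open>G i\<close> do not see the off-diagonal blocks of a density matrix, so such a matrix acts as a mixture of
  \<open>e\<^sub>1 e\<^sub>1\<^sup>*\<close>, which gives \<open>p\<close>, with its normalised lower right block.\<close>

lemma joint_numerical_range_block:
  fixes G :: "'n::finite \<Rightarrow> complex^3^3" and p :: "real^'n"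
  assumes G: "\<And>i. hermitian (G i)"
    and e: "\<And>i. G i *v axis 1 1 = complex_of_real (p $ i) *s axis 1 1"
  obtains c and f :: "real^3 \<Rightarrow> real^'n" where "linear f"
    "joint_numerical_range G = convex hull (insert p ((\<lambda>x. c + f x) ` cball 0 1))"
proof -
  define c :: "real^'n" where "c = (\<chi> i. (Re (G i $ 2 $ 2) + Re (G i $ 3 $ 3)) / 2)"
  define f :: "real^3 \<Rightarrow> real^'n" where "f x = (\<chi> i. x $ 1 * Re (G i $ 2 $ 3) + x $ 2 * Im (G i $ 2 $ 3)
    + x $ 3 * (Re (G i $ 2 $ 2) - Re (G i $ 3 $ 3)) / 2)" for x
  define L where "L \<rho> = (\<chi> i. Re (trace (\<rho> ** G i)))" for \<rho>
  define B where "B = (\<lambda>x. c + f x) ` cball 0 1"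
  have nsq: "(norm x)\<^sup>2 = (x $ 1)\<^sup>2 + (x $ 2)\<^sup>2 + (x $ 3)\<^sup>2" for x :: "real^3"
    by (simp add: norm_vec_def L2_set_def sum_3)
  have range: "joint_numerical_range G = L ` density_matrices"
    by (simp add: joint_numerical_range_image L_def[abs_def])
  have "linear f"
    by (intro linearI) (simp_all add: f_def vec_eq_iff field_simps)
  have tr: "L \<rho> $ i = Re (\<rho> $ 1 $ 1) * p $ i + Re (\<rho> $ 2 $ 2) * Re (G i $ 2 $ 2)
    + Re (\<rho> $ 3 $ 3) * Re (G i $ 3 $ 3)
    + 2 * (Re (\<rho> $ 2 $ 3) * Re (G i $ 2 $ 3) + Im (\<rho> $ 2 $ 3) * Im (G i $ 2 $ 3))"
    if "\<rho> \<in> density_matrices" for \<rho> i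
    using trace_mult_block[OF _ G e] that
    by (simp add: L_def density_matrices_def positive_semidefinite_hinner)
  have "insert p B \<subseteq> joint_numerical_range G"
  proof -
    define \<sigma> :: "complex^3^3" where "\<sigma> = rank_one (axis 1 1)"
    have "\<sigma> \<in> density_matrices"
      by (simp add: \<sigma>_def density_matrices_def positive_semidefinite_rank_one)
        (simp add: rank_one_def axis_def trace_def sum_3)
    moreover from this have "L \<sigma> = p"
      by (simp add: vec_eq_iff tr) (simp add: \<sigma>_def rank_one_def axis_def)
    ultimately have "p \<in> joint_numerical_range G"
      unfolding range by blast
    moreover have "c + f x \<in> joint_numerical_range G" if x: "x \<in> cball 0 1" for x
    proof -
      have "(norm x)\<^sup>2 \<le> 1" using x by (simp add: power_le_one)
      then have x1: "(x $ 1)\<^sup>2 + (x $ 2)\<^sup>2 + (x $ 3)\<^sup>2 \<le> 1" by (simp add: nsq)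
      then have "(x $ 3)\<^sup>2 \<le> 1" using zero_le_power2[of "x $ 1"] zero_le_power2[of "x $ 2"] by linarith
      then have x3: "\<bar>x $ 3\<bar> \<le> 1" by (simp add: abs_square_le_1)
      define \<rho> where "\<rho> = block_state ((1 + x $ 3) / 2) ((1 - x $ 3) / 2) (Complex (x $ 1 / 2) (x $ 2 / 2))"
      have "positive_semidefinite \<rho>"
        unfolding \<rho>_def
      proof (rule positive_semidefinite_block_state)
        show "(norm (Complex (x $ 1 / 2) (x $ 2 / 2)))\<^sup>2 \<le> (1 + x $ 3) / 2 * ((1 - x $ 3) / 2)"
          using x1 by (simp add: cmod_power2) (simp add: power2_eq_square field_simps)
      qed (use x3 in auto)
      moreover have "trace \<rho> = 1"
        by (simp add: \<rho>_def block_state_def trace_def sum_3 complex_eq_iff field_simps)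
      ultimately have \<rho>: "\<rho> \<in> density_matrices" by (simp add: density_matrices_def)
      have "L \<rho> = c + f x"
        by (simp add: vec_eq_iff tr[OF \<rho>]) (simp add: \<rho>_def block_state_def c_def f_def field_simps)
      then show ?thesis unfolding range using \<rho> by (metis imageI)
    qed
    ultimately show ?thesis by (auto simp: B_def)
  qed
  then have sub: "convex hull (insert p B) \<subseteq> joint_numerical_range G"
    by (rule hull_minimal) (rule convex_joint_numerical_range)
  have "L \<rho> \<in> convex hull (insert p B)" if \<rho>: "\<rho> \<in> density_matrices" for \<rho>
  proof -
    have psd: "positive_semidefinite \<rho>" and tr1: "trace \<rho> = 1"
      using \<rho> by (auto simp: density_matrices_def)
    define t where "t = Re (\<rho> $ 1 $ 1)"
    define a where "a = Re (\<rho> $ 2 $ 2)"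
    define b where "b = Re (\<rho> $ 3 $ 3)"
    define z where "z = \<rho> $ 2 $ 3"
    have nonneg: "t \<ge> 0" "a \<ge> 0" "b \<ge> 0"
      using positive_semidefinite_diagonal_nonneg[OF psd] by (simp_all add: t_def a_def b_def)
    have sum1: "t + a + b = 1"
      using arg_cong[OF tr1, of Re] by (simp add: trace_def sum_3 t_def a_def b_def)
    have zab: "(norm z)\<^sup>2 \<le> a * b"
      using positive_semidefinite_entry_bound[OF psd, of 2 3] by (simp add: z_def a_def b_def)
    have L: "L \<rho> $ i = t * p $ i + a * Re (G i $ 2 $ 2) + b * Re (G i $ 3 $ 3)
        + 2 * (Re z * Re (G i $ 2 $ 3) + Im z * Im (G i $ 2 $ 3))" for i
      by (simp add: tr[OF \<rho>] t_def a_def b_def z_def)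
    show ?thesis
    proof (cases "a + b = 0")
      case True
      with nonneg have ab: "a = 0" "b = 0" by auto
      with zab have "z = 0" by simp
      with ab sum1 have "L \<rho> = p" by (simp add: vec_eq_iff L)
      then show ?thesis by (simp add: hull_inc)
    next
      case False
      define m where "m = a + b"
      have m: "m > 0" using False nonneg by (simp add: m_def)
      define x :: "real^3" where "x = vector [2 * Re z / m, 2 * Im z / m, (a - b) / m]"
      have "(norm x)\<^sup>2 = (4 * (norm z)\<^sup>2 + (a - b)\<^sup>2) / m\<^sup>2"
        by (simp add: nsq x_def cmod_power2 power_divide power_mult_distrib add_divide_distrib)
      also have "\<dots> \<le> (4 * (a * b) + (a - b)\<^sup>2) / m\<^sup>2"
        using zab by (intro divide_right_mono) auto
      also have "\<dots> = 1"
      proof -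
        have "4 * (a * b) + (a - b)\<^sup>2 = m\<^sup>2"
          by (simp add: m_def power2_eq_square algebra_simps)
        then show ?thesis using m by simp
      qed
      finally have "x \<in> cball 0 1"
        by (simp add: power2_le_imp_le[of _ 1])
      then have "c + f x \<in> convex hull (insert p B)" and "p \<in> convex hull (insert p B)"
        by (auto simp: B_def intro!: hull_inc)
      then have "t *\<^sub>R p + m *\<^sub>R (c + f x) \<in> convex hull (insert p B)"
        using sum1 nonneg m by (intro convexD[OF convex_convex_hull]) (auto simp: m_def)
      moreover have "L \<rho> = t *\<^sub>R p + m *\<^sub>R (c + f x)"
      proof -
        have mx: "m * x $ 1 = 2 * Re z" "m * x $ 2 = 2 * Im z" "m * x $ 3 = a - b"
          using m by (simp_all add: x_def)
        have block: "m * c $ i + m * f x $ i = a * Re (G i $ 2 $ 2) + b * Re (G i $ 3 $ 3)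
            + 2 * (Re z * Re (G i $ 2 $ 3) + Im z * Im (G i $ 2 $ 3))" for i
        proof -
          have "m * c $ i + m * f x $ i = m * (Re (G i $ 2 $ 2) + Re (G i $ 3 $ 3)) / 2
              + (m * x $ 1) * Re (G i $ 2 $ 3) + (m * x $ 2) * Im (G i $ 2 $ 3)
              + (m * x $ 3) * (Re (G i $ 2 $ 2) - Re (G i $ 3 $ 3)) / 2"
            by (simp add: c_def f_def field_simps)
          then show ?thesis
            unfolding mx by (simp add: m_def field_simps)
        qed
        have "L \<rho> $ i = t * p $ i + (m * c $ i + m * f x $ i)" for i
          unfolding block L by simp
        then show ?thesis
          by (simp add: vec_eq_iff distrib_left)
      qed
      ultimately show ?thesis by simp
    qed
  qed
  then have "joint_numerical_range G \<subseteq> convex hull (insert p B)"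
    by (auto simp: range)
  with sub \<open>linear f\<close> show thesis
    by (intro that[of f c]) (auto simp: B_def)
qed

text \<open>The previous lemma up to a unitary that moves the eigenvector to the first basis vector.\<close>

lemma joint_numerical_range_common_eigenvector:
  fixes F :: "'n::finite \<Rightarrow> complex^3^3" and p :: "real^'n"
  assumes F: "\<And>i. hermitian (F i)"
    and v: "v \<noteq> 0" "\<And>i. F i *v v = complex_of_real (p $ i) *s v"
  obtains c and f :: "real^3 \<Rightarrow> real^'n" where "linear f"
    "joint_numerical_range F = convex hull (insert p ((\<lambda>x. c + f x) ` cball 0 1))"
proof -
  obtain H a where H: "hermitian H" "H ** H = mat 1" and col: "H *v axis 1 1 = a *s v"
    using exists_hermitian_unitary_with_column[OF v(1)] .
  define G where "G i = H ** F i ** H" for i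
  have "hermitian (G i)" for i
    unfolding G_def using H(1) F by (rule hermitian_conjugate)
  moreover have "G i *v axis 1 1 = complex_of_real (p $ i) *s axis 1 1" for i
  proof -
    have "G i *v axis 1 1 = H *v (F i *v (a *s v))"
      by (simp add: G_def matrix_vector_mul_assoc[symmetric] col)
    also have "\<dots> = complex_of_real (p $ i) *s (H *v (H *v axis 1 1))"
      unfolding col by (simp add: vector_scalar_commute v(2) vector_smult_assoc mult.commute)
    also have "\<dots> = complex_of_real (p $ i) *s axis 1 1"
      by (simp add: matrix_vector_mul_assoc H)
    finally show ?thesis .
  qed
  ultimately obtain c and f :: "real^3 \<Rightarrow> real^'n" where "linear f"
    "joint_numerical_range G = convex hull (insert p ((\<lambda>x. c + f x) ` cball 0 1))"
    using joint_numerical_range_block[of G p] by blast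
  then show thesis
    using that[of f c] joint_numerical_range_conjugate[OF H, of F] by (simp add: G_def[abs_def])
qed

section \<open>Convex hulls of a point and an affine image of the ball\<close>

text \<open>The orthogonal projection onto the orthogonal complement of the kernel of \<open>f\<close> preserves \<open>f\<close> and
  maps the unit ball onto the unit ball of the complement. Hence \<open>f\<close> can be restricted to this
  complement, which is isometric to the Euclidean space whose dimension is the rank of \<open>f\<close>.\<close>

lemma cball_image_eq_injective_cball_image:
  fixes f :: "'c::euclidean_space \<Rightarrow> 'a::euclidean_space"
  assumes f: "linear f" and r: "dim (range f) = DIM('b::euclidean_space)"
  obtains g :: "'b::euclidean_space \<Rightarrow> 'a" where "linear g" "inj g" "g ` cball 0 1 = f ` cball 0 1"
proof -
  define K where "K = {x. f x = 0}"
  define W where "W = {y. \<forall>x\<in>K. orthogonal x y}"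
  have K: "subspace K"
    using f unfolding K_def by (rule linear_subspace_kernel)
  have W: "subspace W"
    unfolding W_def by (rule subspace_orthogonal_to_vectors)
  have KW: "x = 0" if "x \<in> K" "x \<in> W" for x
    using that by (auto simp: W_def orthogonal_self)
  have split: "\<exists>k\<in>K. \<exists>w\<in>W. x = k + w" for x
  proof -
    obtain k w where kw: "k \<in> span K" "\<And>u. u \<in> span K \<Longrightarrow> orthogonal w u" "x = k + w"
      by (rule orthogonal_subspace_decomp_exists[of K x]) (rule that)
    then have "w \<in> W"
      by (auto simp: W_def orthogonal_commute span_base)
    moreover have "k \<in> K"
      using kw(1) K by (metis span_eq_iff)
    ultimately show ?thesis
      using kw(3) by blast
  qed
  have fW: "f ` W = range f"
  proof -
    have "f x \<in> f ` W" for x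
    proof -
      obtain k w where "k \<in> K" "w \<in> W" "x = k + w"
        using split by blast
      then show ?thesis
        using f by (auto simp: K_def linear_add)
    qed
    then show ?thesis by auto
  qed
  have injW: "inj_on f W"
    using K W KW f by (auto simp: K_def linear_inj_on_iff_eq_0)
  have "dim W = dim (range f)"
    using dim_image_eq[of f W] f injW fW span_eq_iff[THEN iffD2, OF W] by simp
  with r have "dim (UNIV :: 'b set) = dim W" by simp
  then obtain h :: "'b \<Rightarrow> 'c" and h' where h: "linear h" "h ` UNIV = W"
    "\<And>x. norm (h x) = norm x"
    using isometries_subspaces[OF subspace_UNIV W] by (metis UNIV_I)
  show thesis
  proof
    show lin: "linear (f \<circ> h)"
      using h(1) f by (rule linear_compose)
    have "h x = 0" if "f (h x) = 0" for x
      using KW[of "h x"] h(2) that by (auto simp: K_def)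
    then have "x = 0" if "f (h x) = 0" for x
      using h(3)[of x] that by force
    then show "inj (f \<circ> h)"
      using lin by (auto simp: linear_injective_0)
    show "(f \<circ> h) ` cball 0 1 = f ` cball 0 1"
    proof
      show "(f \<circ> h) ` cball 0 1 \<subseteq> f ` cball 0 1"
        using h(3) by auto
      show "f ` cball 0 1 \<subseteq> (f \<circ> h) ` cball 0 1"
      proof clarify
        fix x :: 'c assume x: "x \<in> cball 0 1"
        obtain k w where kw: "k \<in> K" "w \<in> W" "x = k + w"
          using split by blast
        have "orthogonal k w" using kw by (auto simp: W_def)
        then have "(norm x)\<^sup>2 = (norm k)\<^sup>2 + (norm w)\<^sup>2"
          unfolding kw(3) by (rule norm_add_Pythagorean)
        then have "(norm w)\<^sup>2 \<le> (norm x)\<^sup>2" by simp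
        then have wx: "norm w \<le> norm x" using power2_le_imp_le by force
        obtain y where y: "w = h y" using kw(2) h(2) by blast
        have "f x = f (h y)"
          using kw f y by (simp add: K_def linear_add)
        then show "f x \<in> (f \<circ> h) ` cball 0 1"
          using wx x y h(3)[of y] by auto
      qed
    qed
  qed
qed

text \<open>A linear image of the ball has no corner unless its dimension is at most one. If \<open>u\<close> is normal at
  \<open>f x0\<close>, then the linear functional given by the adjoint of \<open>f\<close> at \<open>u\<close> is maximal on the ball at \<open>x0\<close>,
  hence is a multiple of \<open>x0\<close>. If such \<open>u\<close> affinely span the space, then the adjoint has rank at most
  one, and so has \<open>f\<close>.\<close>

lemma ball_image_corner_dim_le_1:
  fixes f :: "'b::euclidean_space \<Rightarrow> 'a::euclidean_space"
  assumes f: "linear f" and x0: "x0 \<in> cball 0 1"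
    and N: "affine hull N = UNIV"
    and max: "\<And>u x. u \<in> N \<Longrightarrow> x \<in> cball 0 1 \<Longrightarrow> u \<bullet> f x \<le> u \<bullet> f x0"
  shows "dim (range f) \<le> 1"
proof -
  have *: "adjoint f u = norm (adjoint f u) *\<^sub>R x0" if "u \<in> N" for u
  proof (cases "adjoint f u = 0")
    case False
    define a where "a = adjoint f u"
    have a: "u \<bullet> f x = a \<bullet> x" for x
      using adjoint_works[OF f, of x u] by (simp add: a_def inner_commute)
    have "a \<bullet> (a /\<^sub>R norm a) \<le> a \<bullet> x0"
      using max[OF that, of "a /\<^sub>R norm a"] False unfolding a by (simp add: a_def)
    then have ax: "norm a \<le> a \<bullet> x0"
      using False by (simp add: a_def dot_square_norm power2_eq_square field_simps)
    have nx: "norm a * norm x0 \<le> norm a"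
      using x0 by (simp add: mult_left_le)
    have "a \<bullet> x0 \<le> norm a * norm x0" by (rule norm_cauchy_schwarz)
    with ax nx have eq: "a \<bullet> x0 = norm a * norm x0" "norm a * norm x0 = norm a" by linarith+
    with False have "norm x0 = 1" by (simp add: a_def)
    then show ?thesis
      using eq(1) norm_cauchy_schwarz_eq[of a x0] by (simp add: a_def)
  qed simp
  define S where "S = {u. adjoint f u \<in> span {x0}}"
  have "subspace S"
    unfolding S_def using linear_subspace_vimage[OF adjoint_linear[OF f] subspace_span]
    by (simp add: vimage_def)
  moreover have "N \<subseteq> S"
    using * by (metis (mono_tags, lifting) S_def mem_Collect_eq singletonI span_base span_scale subsetI)
  ultimately have "S = UNIV"
    by (metis N hull_minimal subspace_imp_affine top.extremum_uniqueI)
  then have S: "adjoint f u \<in> span {x0}" for u by (auto simp: S_def)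
  have ker: "f x = 0" if "orthogonal x x0" for x
  proof -
    have "f x \<bullet> f x = x \<bullet> adjoint f (f x)"
      by (simp add: adjoint_works[OF f])
    also have "\<dots> = 0"
      using S[of "f x"] that by (auto simp: span_singleton orthogonal_def)
    finally show ?thesis by simp
  qed
  have "f x \<in> span {f x0}" for x
  proof -
    obtain y z where yz: "y \<in> span {x0}" "\<And>w. w \<in> span {x0} \<Longrightarrow> orthogonal z w" "x = y + z"
      by (rule orthogonal_subspace_decomp_exists[of "{x0}" x]) (rule that)
    then have "f z = 0" by (simp add: ker span_base)
    then have "f x = f y" using yz(3) f by (simp add: linear_add)
    then show ?thesis
      using yz(1) f by (auto simp: span_singleton linear_scale)
  qed
  then have "range f \<subseteq> span {f x0}" by blast
  then have "dim (range f) \<le> dim {f x0}" by (rule dim_mono)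
  also have "\<dots> \<le> card {f x0}" by (rule dim_le_card') simp
  finally show ?thesis by simp
qed

lemma affine_hull_ball_image:
  fixes f :: "'b::euclidean_space \<Rightarrow> 'a::euclidean_space"
  assumes "linear f"
  shows "affine hull ((\<lambda>x. c + f x) ` cball 0 1) = (+) c ` range f"
proof -
  have cb: "affine hull (cball 0 1 :: 'b set) = UNIV"
    by (metis affine_hull_nonempty_interior interior_cball ball_eq_empty not_one_le_zero)
  have "affine hull ((\<lambda>x. c + f x) ` cball 0 1) = affine hull ((+) c ` (f ` cball 0 1))"
    by (simp add: image_image)
  also have "\<dots> = (+) c ` f ` (affine hull cball 0 1)"
    unfolding affine_hull_translation 
    by (simp add: affine_hull_linear_image assms linear_conv_bounded_linear[symmetric])
  finally show ?thesis by (simp add: cb)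
qed

lemma convex_hull_sphere_eq_cball:
  "convex hull sphere 0 1 = (cball 0 1 :: 'b::euclidean_space set)"
  using Krein_Milman_frontier[of "cball 0 1 :: 'b set"] by (simp add: frontier_cball)

lemma convex_hull_sphere_image:
  fixes g :: "'b::euclidean_space \<Rightarrow> 'a::euclidean_space"
  assumes "linear g"
  shows "convex hull ((\<lambda>x. c + g x) ` sphere 0 1) = (\<lambda>x. c + g x) ` cball 0 1"
proof -
  have "convex hull ((\<lambda>x. c + g x) ` sphere 0 1) = convex hull ((+) c ` g ` sphere 0 1)"
    by (simp add: image_image)
  also have "\<dots> = (+) c ` g ` cball 0 1"
    unfolding convex_hull_translation
    by (simp add: convex_hull_linear_image[OF assms, symmetric] convex_hull_sphere_eq_cball)
  finally show ?thesis by (simp add: image_image)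
qed

lemma ball_image_eq_hull_sphere_image:
  fixes f :: "'c::euclidean_space \<Rightarrow> 'a::euclidean_space"
  assumes f: "linear f" and dim: "dim (range f) = DIM('b::euclidean_space)"
  obtains g :: "'b::euclidean_space \<Rightarrow> 'a" where "linear g" "inj g"
    "convex hull ((\<lambda>x. c + g x) ` sphere 0 1) = (\<lambda>x. c + f x) ` cball 0 1"
proof -
  obtain g :: "'b \<Rightarrow> 'a" where g: "linear g" "inj g" "g ` cball 0 1 = f ` cball 0 1"
    using cball_image_eq_injective_cball_image[OF f dim] .
  have "convex hull ((\<lambda>x. c + g x) ` sphere 0 1) = (+) c ` g ` cball 0 1"
    unfolding convex_hull_sphere_image[OF g(1)] by (simp add: image_image)
  also have "\<dots> = (\<lambda>x. c + f x) ` cball 0 1"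
    unfolding g(3) by (simp add: image_image)
  finally show thesis using g that by blast
qed

text \<open>The four ranks of \<open>f\<close> account for all cases: the position of \<open>p\<close> relative to the affine hull of the
  image of the ball decides between dimension \<open>r\<close> and \<open>r + 1\<close>. A normal vector of the cone at
  \<open>p\<close> is also normal to the smaller image of the ball if \<open>p\<close> lies in it, so a corner inside the image
  forces \<open>r \<le> 1\<close>.\<close>

lemma cone_over_ball_image_with_corner:
  fixes f :: "real^3 \<Rightarrow> 'a::euclidean_space"
  assumes f: "linear f"
    and K: "K = convex hull (insert p ((\<lambda>x. c + f x) ` cball 0 1))"
    and corner: "corner_point K p" and D: "D = aff_dim K"
  shows "D \<in> {0, 1, 2, 3, 4} \<and>
    (D = 2 \<longrightarrow>
      (\<exists>S. is_segment S \<and> p \<notin> affine hull S \<and> K = convex hull ({p} \<union> S)) \<or>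
      (\<exists>E. is_ellipse E \<and> p \<in> affine hull E \<and> p \<notin> convex hull E \<and>
           K = convex hull ({p} \<union> E))) \<and>
    (D = 3 \<longrightarrow>
      (\<exists>E. is_ellipse E \<and> p \<notin> affine hull E \<and> K = convex hull ({p} \<union> E)) \<or>
      (\<exists>E. is_ellipsoid E \<and> p \<in> affine hull E \<and> p \<notin> convex hull E \<and>
           K = convex hull ({p} \<union> E))) \<and>
    (D = 4 \<longrightarrow>
      (\<exists>E. is_ellipsoid E \<and> p \<notin> affine hull E \<and> K = convex hull ({p} \<union> E)))"
proof -
  define B where "B = (\<lambda>x. c + f x) ` cball 0 1"
  define r where "r = dim (range f)"
  have aff_B: "affine hull B = (+) c ` range f"
    unfolding B_def using f by (rule affine_hull_ball_image)
  have "aff_dim B = aff_dim (affine hull B)" by simp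
  also have "\<dots> = int r"
    unfolding aff_B aff_dim_translation_eq r_def
    using f by (intro aff_dim_subspace linear_subspace_image subspace_UNIV)
  finally have D_eq: "D = (if p \<in> affine hull B then int r else int r + 1)"
    by (simp add: D K B_def[symmetric] aff_dim_insert aff_dim_convex_hull)
  have "r \<le> 3"
    using dim_image_le[OF f, of UNIV] by (simp add: r_def)
  have hull: "affine hull S = affine hull B" "convex hull ({p} \<union> S) = K" if "convex hull S = B" for S
  proof -
    show "affine hull S = affine hull B"
      using affine_hull_convex_hull[of S] that by simp
    have "convex hull ({p} \<union> S) = convex hull (convex hull {p} \<union> convex hull S)"
      by (rule hull_Un) (rule convex_Inter, blast)
    then show "convex hull ({p} \<union> S) = K"
      by (simp add: that K B_def)
  qed
  have outside: "p \<notin> B" if "r \<ge> 2"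
  proof
    assume "p \<in> B"
    then obtain x0 where x0: "x0 \<in> cball 0 1" "p = c + f x0"
      by (auto simp: B_def)
    have "u \<bullet> f x \<le> u \<bullet> f x0" if u: "u \<in> normal_cone K p" and x: "x \<in> cball 0 1" for u x
    proof -
      have "c + f x \<in> K"
        unfolding K by (rule hull_inc) (use x in auto)
      with u have "u \<bullet> (c + f x - p) \<le> 0" by (auto simp: normal_cone_def)
      then show ?thesis by (simp add: x0 inner_diff_right inner_add_right)
    qed
    moreover have "affine hull (normal_cone K p) = UNIV"
      using corner unfolding corner_point_def by (intro affine_hull_UNIV) simp
    ultimately have "dim (range f) \<le> 1"
      by (intro ball_image_corner_dim_le_1[OF f x0(1)])
    with that show False by (simp add: r_def)
  qed
  have segment: "\<exists>S. is_segment S \<and> convex hull S = B" if r1: "r = 1"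
  proof -
    obtain g :: "real \<Rightarrow> 'a" where g: "linear g" "inj g"
      and B: "convex hull ((\<lambda>x. c + g x) ` sphere 0 1) = B"
      using ball_image_eq_hull_sphere_image[OF f, where 'b=real and c=c] r1 unfolding r_def B_def by auto
    have "sphere 0 1 = {-1, 1 :: real}" by auto
    then have "B = closed_segment (c + g (-1)) (c + g 1)"
      unfolding B[symmetric] by (simp add: segment_convex_hull insert_commute)
    moreover have "c + g (-1) \<noteq> c + g 1"
      using injD[OF g(2), of "-1" 1] by auto
    ultimately have "is_segment B" unfolding is_segment_def by blast
    moreover have "convex hull B = B"
      using B by (metis convex_convex_hull convex_hull_eq)
    ultimately show ?thesis by blast
  qed
  have ellipse: "\<exists>E. is_ellipse E \<and> convex hull E = B" if "r = 2"
    using ball_image_eq_hull_sphere_image[OF f, where 'b="real^2" and c=c] that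
    unfolding r_def B_def is_ellipse_def by (simp, metis)
  have ellipsoid: "\<exists>E. is_ellipsoid E \<and> convex hull E = B" if "r = 3"
    using ball_image_eq_hull_sphere_image[OF f, where 'b="real^3" and c=c] that
    unfolding r_def B_def is_ellipsoid_def by (simp, metis)
  consider "r = 0" | "r = 1" | "r = 2" | "r = 3"
    using \<open>r \<le> 3\<close> by linarith
  then show ?thesis
  proof cases
    case 1
    then show ?thesis using D_eq by auto
  next
    case 2
    then obtain S where "is_segment S" "convex hull S = B" using segment by blast
    then show ?thesis using D_eq 2 hull[of S] by auto
  next
    case 3
    then obtain S where "is_ellipse S" "convex hull S = B" using ellipse by blast
    then show ?thesis using D_eq 3 hull[of S] outside by auto
  next
    case 4
    then obtain S where "is_ellipsoid S" "convex hull S = B" using ellipsoid by blast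
    then show ?thesis using D_eq 4 hull[of S] outside by auto
  qed
qed

theorem lemma4p10:
  fixes F :: "'n::finite \<Rightarrow> complex^3^3" and p :: "real^'n" and D :: int
  assumes F: "\<And>i. hermitian (F i)"
    and D: "D = aff_dim (joint_numerical_range F)"
    and p: "corner_point (joint_numerical_range F) p"
  shows "D \<in> {0, 1, 2, 3, 4} \<and>
    (D = 2 \<longrightarrow>
      (\<exists>S. is_segment S \<and> p \<notin> affine hull S \<and>
           joint_numerical_range F = convex hull ({p} \<union> S)) \<or>
      (\<exists>E. is_ellipse E \<and> p \<in> affine hull E \<and> p \<notin> convex hull E \<and>
           joint_numerical_range F = convex hull ({p} \<union> E))) \<and>
    (D = 3 \<longrightarrow>
      (\<exists>E. is_ellipse E \<and> p \<notin> affine hull E \<and>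
           joint_numerical_range F = convex hull ({p} \<union> E)) \<or>
      (\<exists>E. is_ellipsoid E \<and> p \<in> affine hull E \<and> p \<notin> convex hull E \<and>
           joint_numerical_range F = convex hull ({p} \<union> E))) \<and>
    (D = 4 \<longrightarrow>
      (\<exists>E. is_ellipsoid E \<and> p \<notin> affine hull E \<and>
           joint_numerical_range F = convex hull ({p} \<union> E)))"
proof -
  obtain v where v: "v \<noteq> 0" "\<And>i. F i *v v = complex_of_real (p $ i) *s v"
    by (rule corner_point_common_eigenvector[OF F p]) (rule that)
  obtain c and f :: "real^3 \<Rightarrow> real^'n" where "linear f"
    "joint_numerical_range F = convex hull (insert p ((\<lambda>x. c + f x) ` cball 0 1))"
    using joint_numerical_range_common_eigenvector[OF F v] .
  then show ?thesis
    using p D by (rule cone_over_ball_image_with_corner)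
qed

end
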